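(* Let $A$ and $Q$ be linear operators on $\mathcal{H}$, where $A$ has eigenfunctions $\{e_k\}_{k\ge1}$ with $Ae_k=-\lambda_ke_k$, and $Q$ is self-adjoint with eigenvalues $\{q_k\}_{k\ge1}$ and corresponding eigenfunctions $\{b_k\}_{k\ge1}$ forming an orthonormal basis of $\mathcal{H}$, such that: (1') there is $D>0$ with $b_j=e_j'$ for all $j>D$; (2') $q_j>0$ for all $j\ge1$; (3') $\sum_{j=1}^\infty q_j(\lambda_j')^{\gamma}<+\infty$ for some $\gamma>-1$; (4') $Q$ is bounded. Let $\alpha\in\mathbb{R}$ with $\alpha<\lambda_1$ be fixed and assume that $A_\alpha=A+\alpha$ is self-adjoint and generates a $\mathcal{C}_0$-contraction semigroup on $\mathcal{H}$. Then the covariance operator $V_\infty$ associated with the linear equation $\mathrm{d}w=A_\alpha w\,\mathrm{d}t+\sigma\,\mathrm{d}W_t$ satisfies $$\langle V_\infty e_{j_1},e_{j_2}\rangle=\frac{\sigma^2}{\lambda_{j_1}+\lambda_{j_2}-2\alpha}\sum_{n=1}^\infty q_n\langle e_{j_1},b_n\rangle\langle e_{j_2},b_n\rangle$$ for all $j_1,j_2\in\mathbb{N}\setminus\{0\}$.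
   Context: $L>0$, $\mathcal{O}=[0,L]$, $\mathcal{H}=L^2(\mathcal{O})$ with scalar product $\langle\cdot,\cdot\rangle$, $\sigma>0$. $\lambda_j'=(\pi j/L)^2$ and $e_j'(x)=\sqrt{2/L}\,\sin(\pi jx/L)$ are (up to sign) the eigenvalues and the normalized eigenfunctions of the Dirichlet Laplacian on $\mathcal{O}$. The eigenvalues $-\lambda_k$ of $A$ are ordered so that $\lambda_1\le\lambda_2\le\cdots$. $W_t$ is a $Q$-Wiener process (cylindrical/generalized if $Q$ is bounded but not trace class). The covariance operator is $$V(t)=\sigma^2\int_0^t e^{A_\alpha s}Qe^{A_\alpha^*s}\,\mathrm{d}s,\qquad V_\infty=\lim_{t\to\infty}V(t),$$ where ${}^*$ is the adjoint in $\mathcal{H}$; $V_\infty$ is the covariance operator of the (Gaussian, mean zero) invariant measure of the linear equation; it is linear, self-adjoint, non-negative and continuous on $\mathcal{H}$. *)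

theory Defs
  imports "HOL-Analysis.Analysis"
begin

text \<open>
  The Hilbert space \<open>L\<^sup>2(\<real>)\<close>: square-integrable functions modulo equality almost everywhere, with
  the inner product \<open>\<integral>f g dx\<close>. Every Lebesgue measurable function agrees almost everywhere with a
  Borel function, so restricting to Borel representatives gives the same space.
\<close>

definition square_integrable :: "(real \<Rightarrow> real) \<Rightarrow> bool" where
  "square_integrable f \<longleftrightarrow> f \<in> borel_measurable lborel \<and> integrable lborel (\<lambda>x. (f x)\<^sup>2)"

lemma square_integrable_mult:
  assumes "square_integrable f" "square_integrable g"
  shows "integrable lborel (\<lambda>x. f x * g x)"
proof (rule Bochner_Integration.integrable_bound)
  show "integrable lborel (\<lambda>x. (f x)\<^sup>2 + (g x)\<^sup>2)"
    using assms by (auto simp: square_integrable_def)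
  show "(\<lambda>x. f x * g x) \<in> borel_measurable lborel"
    using assms by (auto simp: square_integrable_def)
  have "\<bar>a * b\<bar> \<le> a\<^sup>2 + b\<^sup>2" for a b :: real
    using sum_squares_bound[of "\<bar>a\<bar>" "\<bar>b\<bar>"] zero_le_power2[of a] zero_le_power2[of b]
    unfolding abs_mult power2_abs by linarith
  then show "AE x in lborel. norm (f x * g x) \<le> norm ((f x)\<^sup>2 + (g x)\<^sup>2)"
    by (auto intro!: AE_I2)
qed

lemma square_integrable_zero: "square_integrable (\<lambda>_. 0)"
  by (simp add: square_integrable_def)

lemma square_integrable_add:
  assumes "square_integrable f" "square_integrable g"
  shows "square_integrable (\<lambda>x. f x + g x)"
  using assms square_integrable_mult[OF assms]
  by (auto simp: square_integrable_def power2_sum mult.assoc)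

lemma square_integrable_scale:
  assumes "square_integrable f"
  shows "square_integrable (\<lambda>x. c * f x)"
  using assms by (auto simp: square_integrable_def power_mult_distrib)

lemma square_integrable_minus:
  assumes "square_integrable f"
  shows "square_integrable (\<lambda>x. - f x)"
  using assms by (auto simp: square_integrable_def)

lemma square_integrable_diff:
  assumes "square_integrable f" "square_integrable g"
  shows "square_integrable (\<lambda>x. f x - g x)"
  using square_integrable_add[OF assms(1) square_integrable_minus[OF assms(2)]] by simp

quotient_type L2 = "real \<Rightarrow> real" / partial:
  "\<lambda>f g. square_integrable f \<and> square_integrable g \<and> (AE x in lborel. f x = g x)"
proof (rule part_equivpI)
  show "\<exists>f. square_integrable f \<and> square_integrable f \<and> (AE x in lborel. f x = f x)"
    using square_integrable_zero by auto
  show "symp (\<lambda>f g. square_integrable f \<and> square_integrable g \<and> (AE x in lborel. f x = g x))"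
    by (auto intro!: sympI)
  show "transp (\<lambda>f g. square_integrable f \<and> square_integrable g \<and> (AE x in lborel. f x = g x))"
    by (rule transpI) (auto simp: eventually_conj_iff elim: eventually_elim2)
qed

instantiation L2 :: real_inner
begin

lift_definition zero_L2 :: L2 is "\<lambda>_. 0"
  by (simp add: square_integrable_zero)

lift_definition plus_L2 :: "L2 \<Rightarrow> L2 \<Rightarrow> L2" is "\<lambda>f g x. f x + g x"
  by (auto intro: square_integrable_add)

lift_definition uminus_L2 :: "L2 \<Rightarrow> L2" is "\<lambda>f x. - f x"
  by (auto intro: square_integrable_minus)

lift_definition minus_L2 :: "L2 \<Rightarrow> L2 \<Rightarrow> L2" is "\<lambda>f g x. f x - g x"
  by (auto intro: square_integrable_diff)

lift_definition scaleR_L2 :: "real \<Rightarrow> L2 \<Rightarrow> L2" is "\<lambda>c f x. c * f x"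
  by (auto intro: square_integrable_scale)

lift_definition inner_L2 :: "L2 \<Rightarrow> L2 \<Rightarrow> real" is "\<lambda>f g. LINT x|lborel. f x * g x"
  by (rule integral_cong_AE) (auto simp: square_integrable_def)

definition norm_L2 :: "L2 \<Rightarrow> real" where "norm_L2 u = sqrt (inner u u)"
definition dist_L2 :: "L2 \<Rightarrow> L2 \<Rightarrow> real" where "dist_L2 u v = norm (u - v)"
definition sgn_L2 :: "L2 \<Rightarrow> L2" where "sgn_L2 u = inverse (norm u) *\<^sub>R u"
definition uniformity_L2 :: "(L2 \<times> L2) filter" where
  "uniformity_L2 = (INF e\<in>{0<..}. principal {(u, v). dist u v < e})"
definition open_L2 :: "L2 set \<Rightarrow> bool" where
  "open_L2 U \<longleftrightarrow> (\<forall>x\<in>U. eventually (\<lambda>(x', y). x' = x \<longrightarrow> y \<in> U) uniformity)"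

instance
proof
  fix u v w :: L2 and c d :: real
  show "u + v + w = u + (v + w)"
    by transfer (auto intro!: square_integrable_add simp: add.assoc)
  show "u + v = v + u"
    by transfer (auto intro!: square_integrable_add simp: add.commute)
  show "0 + u = u"
    by transfer auto
  show "- u + u = 0"
    by transfer (auto simp: square_integrable_zero)
  show "u - v = u + - v"
    by transfer (auto intro!: square_integrable_diff)
  show "c *\<^sub>R (u + v) = c *\<^sub>R u + c *\<^sub>R v"
    by transfer (auto intro!: square_integrable_scale square_integrable_add simp: distrib_left)
  show "(c + d) *\<^sub>R u = c *\<^sub>R u + d *\<^sub>R u"
    by transfer (auto intro!: square_integrable_scale square_integrable_add simp: distrib_right)
  show "c *\<^sub>R d *\<^sub>R u = (c * d) *\<^sub>R u"
    by transfer (auto intro!: square_integrable_scale simp: mult.assoc)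
  show "1 *\<^sub>R u = u"
    by transfer auto
  show "inner u v = inner v u"
    by transfer (simp add: mult.commute)
  show "inner (u + v) w = inner u w + inner v w"
    by transfer (simp add: distrib_right square_integrable_mult)
  show "inner (c *\<^sub>R u) v = c * inner u v"
    by transfer (simp add: mult.assoc)
  show "0 \<le> inner u u"
    by transfer (simp add: integral_nonneg_AE)
  show "inner u u = 0 \<longleftrightarrow> u = 0"
  proof transfer
    fix f :: "real \<Rightarrow> real"
    assume f: "square_integrable f \<and> square_integrable f \<and> (AE x in lborel. f x = f x)"
    then have "(LINT x|lborel. f x * f x) = 0 \<longleftrightarrow> (AE x in lborel. f x * f x = 0)"
      by (intro integral_nonneg_eq_0_iff_AE square_integrable_mult) auto
    then show "(LINT x|lborel. f x * f x) = 0 \<longleftrightarrow>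
        square_integrable f \<and> square_integrable (\<lambda>_. 0) \<and> (AE x in lborel. f x = 0)"
      using f by (simp add: square_integrable_zero)
  qed
  show "norm u = sqrt (inner u u)" by (rule norm_L2_def)
  show "dist u v = norm (u - v)" by (rule dist_L2_def)
  show "sgn u = inverse (norm u) *\<^sub>R u" by (rule sgn_L2_def)
  show "uniformity = (INF e\<in>{0<..}. principal {(u, v :: L2). dist u v < e})"
    by (rule uniformity_L2_def)
  show "open U \<longleftrightarrow> (\<forall>x\<in>U. eventually (\<lambda>(x', y). x' = x \<longrightarrow> y \<in> U) uniformity)" for U :: "L2 set"
    by (rule open_L2_def)
qed

end

lemma L2_repr:
  obtains f where "square_integrable f" "u = abs_L2 f"
proof -
  have "\<exists>f. square_integrable f \<and> u = abs_L2 f"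
    by (induct u rule: L2.abs_induct) auto
  then show ?thesis using that by blast
qed

lemma norm_abs_L2_diff:
  assumes "square_integrable f" "square_integrable g"
  shows "(norm (abs_L2 f - abs_L2 g))\<^sup>2 = (LINT x|lborel. (f x - g x)\<^sup>2)"
  using assms
  by (simp add: power2_norm_eq_inner minus_L2.abs_eq inner_L2.abs_eq square_integrable_diff)
    (simp add: power2_eq_square)

lemma quarter_power: "((1/2)^n)\<^sup>2 = (1/4 :: real)^n"
proof -
  have "((1/2)^n)\<^sup>2 = ((1/2)\<^sup>2 :: real)^n"
    by (simp only: power_mult[symmetric] mult.commute)
  then show ?thesis by (simp add: power2_eq_square)
qed

lemma abs_le_weighted_square:
  fixes a c t :: real
  assumes "a > 0" "a * c = 1"
  shows "\<bar>t\<bar> \<le> a * t\<^sup>2 + c"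
proof -
  have "c > 0" using assms by (metis zero_less_mult_pos zero_less_one)
  have "0 \<le> c * (a * \<bar>t\<bar> - 1)\<^sup>2" using \<open>c > 0\<close> by simp
  also have "\<dots> = (a * c) * (a * \<bar>t\<bar>\<^sup>2) - (a * c) * (2 * \<bar>t\<bar>) + c"
    by (simp add: power2_eq_square algebra_simps)
  finally show ?thesis using assms by simp
qed

lemma L2_Cauchy_convergent:
  fixes X :: "nat \<Rightarrow> L2"
  assumes X: "Cauchy X"
  shows "convergent X"
proof -
  have "\<forall>n. \<exists>N. \<forall>m\<ge>N. \<forall>k\<ge>N. dist (X m) (X k) < (1/2)^n"
    using X unfolding Cauchy_def by simp
  then obtain N where N: "\<And>n m k. m \<ge> N n \<Longrightarrow> k \<ge> N n \<Longrightarrow> dist (X m) (X k) < (1/2)^n"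
    by metis
  define r where "r n = n + (\<Sum>i\<le>n. N i)" for n
  have r: "strict_mono r"
    by (rule strict_monoI_Suc) (simp add: r_def)
  have rN: "r m \<ge> N n" if "m \<ge> n" for m n
  proof -
    have "N n \<le> (\<Sum>i\<le>m. N i)" using that by (intro member_le_sum) auto
    then show ?thesis by (simp add: r_def)
  qed
  have "\<exists>f. square_integrable f \<and> X (r n) = abs_L2 f" for n
    by (meson L2_repr)
  then obtain f where sq: "\<And>n. square_integrable (f n)" and Xf: "\<And>n. X (r n) = abs_L2 (f n)"
    by metis
  have meas [measurable]: "f n \<in> borel_measurable lborel" for n
    using sq[of n] by (simp add: square_integrable_def)
  have diff: "(LINT x|lborel. (f m x - f k x)\<^sup>2) \<le> (1/4)^n" if "m \<ge> n" "k \<ge> n" for m k n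
  proof -
    have "norm (abs_L2 (f m) - abs_L2 (f k)) \<le> (1/2)^n"
      using N[OF rN[OF that(1)] rN[OF that(2)]] by (simp add: Xf dist_norm)
    then have "(norm (abs_L2 (f m) - abs_L2 (f k)))\<^sup>2 \<le> ((1/2)^n)\<^sup>2"
      by (intro power_mono) auto
    also have "((1/2)^n)\<^sup>2 = (1/4 :: real)^n"
      by (rule quarter_power)
    finally show ?thesis by (simp add: norm_abs_L2_diff sq)
  qed
  have nn: "(\<integral>\<^sup>+x. ennreal ((f m x - f k x)\<^sup>2) \<partial>lborel) \<le> ennreal ((1/4)^n)"
    if "m \<ge> n" "k \<ge> n" for m k n
    using diff[OF that] square_integrable_diff[OF sq[of m] sq[of k]]
    by (subst nn_integral_eq_integral) (auto simp: square_integrable_def ennreal_leI)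
  define d where "d n x = f (Suc n) x - f n x" for n x
  have int_sum: "(\<integral>\<^sup>+x. (\<Sum>n. ennreal (2^n * (d n x)\<^sup>2)) \<partial>lborel) =
      (\<Sum>n. \<integral>\<^sup>+x. ennreal (2^n * (d n x)\<^sup>2) \<partial>lborel)"
    by (rule nn_integral_suminf) (simp add: d_def)
  have "(\<integral>\<^sup>+x. ennreal (2^n * (d n x)\<^sup>2) \<partial>lborel) \<le> ennreal ((1/2)^n)" for n
  proof -
    have "(2::real)^n * (1/4)^n = (2 * (1/4))^n"
      by (rule power_mult_distrib[symmetric])
    then have half: "(2::real)^n * (1/4)^n = (1/2)^n"
      by simp
    have "(\<integral>\<^sup>+x. ennreal (2^n * (d n x)\<^sup>2) \<partial>lborel) =
        ennreal (2^n) * (\<integral>\<^sup>+x. ennreal ((d n x)\<^sup>2) \<partial>lborel)"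
      by (simp add: ennreal_mult d_def nn_integral_cmult)
    also have "\<dots> \<le> ennreal (2^n) * ennreal ((1/4)^n)"
      unfolding d_def by (intro mult_left_mono nn) auto
    also have "\<dots> = ennreal (2^n * (1/4)^n)"
      by (rule ennreal_mult[symmetric]) auto
    finally show ?thesis unfolding half .
  qed
  then have "(\<Sum>n. \<integral>\<^sup>+x. ennreal (2^n * (d n x)\<^sup>2) \<partial>lborel) \<le> (\<Sum>n. ennreal ((1/2)^n))"
    by (intro suminf_le allI) auto
  moreover have "(\<Sum>n. ennreal ((1/2)^n)) = ennreal (\<Sum>n. (1/2)^n)"
    by (rule suminf_ennreal2) (auto intro: summable_geometric)
  ultimately have "(\<Sum>n. \<integral>\<^sup>+x. ennreal (2^n * (d n x)\<^sup>2) \<partial>lborel) \<le> ennreal (\<Sum>n. (1/2)^n)"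
    by (rule ord_le_eq_trans)
  then have "(\<integral>\<^sup>+x. (\<Sum>n. ennreal (2^n * (d n x)\<^sup>2)) \<partial>lborel) < \<infinity>"
    unfolding int_sum infinity_ennreal_def by (rule order.strict_trans1[OF _ ennreal_less_top])
  then have fin: "(\<integral>\<^sup>+x. (\<Sum>n. ennreal (2^n * (d n x)\<^sup>2)) \<partial>lborel) \<noteq> \<infinity>"
    by simp
  have "AE x in lborel. (\<Sum>n. ennreal (2^n * (d n x)\<^sup>2)) \<noteq> \<infinity>"
    by (rule nn_integral_noteq_infinite[OF _ fin]) (simp add: d_def)
  then have conv: "AE x in lborel. convergent (\<lambda>n. f n x)"
  proof eventually_elim
    case (elim x)
    have "summable (\<lambda>n. 2^n * (d n x)\<^sup>2)"
      using elim by (intro summable_suminf_not_top) auto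
    then have "summable (\<lambda>n. 2^n * (d n x)\<^sup>2 + (1/2)^n)"
      by (intro summable_add summable_geometric) auto
    moreover have "norm (d n x) \<le> 2^n * (d n x)\<^sup>2 + (1/2)^n" for n
    proof -
      have "(2::real)^n * (1/2)^n = (2 * (1/2))^n"
        by (rule power_mult_distrib[symmetric])
      then show ?thesis
        unfolding real_norm_def by (intro abs_le_weighted_square) auto
    qed
    ultimately have "summable (\<lambda>n. d n x)"
      by (rule summable_comparison_test'[of _ 0])
    then have "convergent (\<lambda>n. (\<Sum>i<n. d i x) + f 0 x)"
      by (intro convergent_add convergent_const) (simp add: summable_iff_convergent)
    moreover have "(\<lambda>n. (\<Sum>i<n. d i x) + f 0 x) = (\<lambda>n. f n x)"
      by (simp add: d_def sum_lessThan_telescope[of "\<lambda>n. f n x"])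
    ultimately show ?case
      by simp
  qed
  define g where "g x = lim (\<lambda>n. f n x)" for x
  have [measurable]: "g \<in> borel_measurable lborel"
    unfolding g_def by (rule borel_measurable_lim_metric) (rule meas)
  have gn: "(\<integral>\<^sup>+x. ennreal ((g x - f n x)\<^sup>2) \<partial>lborel) \<le> ennreal ((1/4)^n)" for n
  proof -
    have "AE x in lborel. ennreal ((g x - f n x)\<^sup>2) = liminf (\<lambda>m. ennreal ((f m x - f n x)\<^sup>2))"
      using conv
    proof eventually_elim
      case (elim x)
      then have "(\<lambda>m. f m x) \<longlonglongrightarrow> g x"
        by (simp add: g_def convergent_LIMSEQ_iff)
      then have "(\<lambda>m. (f m x - f n x)\<^sup>2) \<longlonglongrightarrow> (g x - f n x)\<^sup>2"
        by (intro tendsto_intros)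
      then have "(\<lambda>m. ennreal ((f m x - f n x)\<^sup>2)) \<longlonglongrightarrow> ennreal ((g x - f n x)\<^sup>2)"
        by (rule tendsto_ennrealI)
      then show ?case
        by (intro lim_imp_Liminf[symmetric]) auto
    qed
    then have "(\<integral>\<^sup>+x. ennreal ((g x - f n x)\<^sup>2) \<partial>lborel) =
        (\<integral>\<^sup>+x. liminf (\<lambda>m. ennreal ((f m x - f n x)\<^sup>2)) \<partial>lborel)"
      by (rule nn_integral_cong_AE)
    also have "\<dots> \<le> liminf (\<lambda>m. \<integral>\<^sup>+x. ennreal ((f m x - f n x)\<^sup>2) \<partial>lborel)"
      by (rule nn_integral_liminf) simp
    also have "\<dots> \<le> limsup (\<lambda>m. \<integral>\<^sup>+x. ennreal ((f m x - f n x)\<^sup>2) \<partial>lborel)"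
      by (rule Liminf_le_Limsup) simp
    also have "\<dots> \<le> ennreal ((1/4)^n)"
      by (rule Limsup_bounded) (auto simp: eventually_sequentially intro!: exI[of _ n] nn)
    finally show ?thesis .
  qed
  have sqgn: "square_integrable (\<lambda>x. g x - f n x)" for n
  proof -
    have "integrable lborel (\<lambda>x. (g x - f n x)\<^sup>2)"
      using gn[of n] by (intro integrableI_nonneg) (auto intro: le_less_trans)
    then show ?thesis by (simp add: square_integrable_def)
  qed
  have sqg: "square_integrable g"
    using square_integrable_add[OF sqgn[of 0] sq[of 0]] by simp
  have "norm (X (r n) - abs_L2 g) \<le> (1/2)^n" for n
  proof -
    have "ennreal (LINT x|lborel. (g x - f n x)\<^sup>2) \<le> ennreal ((1/4)^n)"
      using gn[of n] sqgn[of n]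
      by (subst (asm) nn_integral_eq_integral) (auto simp: square_integrable_def)
    then have "(norm (abs_L2 g - X (r n)))\<^sup>2 \<le> (1/4)^n"
      by (simp add: Xf norm_abs_L2_diff sq sqg)
    also have "(1/4 :: real)^n = ((1/2)^n)\<^sup>2"
      by (rule quarter_power[symmetric])
    finally show ?thesis
      unfolding norm_minus_commute[of "X (r n)"] by (rule power2_le_imp_le) simp
  qed
  then have "(\<lambda>n. X (r n) - abs_L2 g) \<longlonglongrightarrow> 0"
    by (intro Lim_null_comparison[OF _ LIMSEQ_realpow_zero[of "1/2"]]) auto
  then have "(X \<circ> r) \<longlonglongrightarrow> abs_L2 g"
    by (simp add: o_def LIM_zero_iff)
  then show ?thesis
    using Cauchy_converges_subseq[OF X r] convergentI by blast
qed

instance L2 :: banach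
  by standard (rule L2_Cauchy_convergent)


text \<open>
  For a real interval \<open>\<O>\<close>, \<open>L\<^sup>2(\<O>)\<close> is identified, by extension by zero, with the closed
  subspace of \<open>L\<^sup>2(\<real>)\<close> of the classes that vanish almost everywhere outside \<open>\<O>\<close>.
\<close>

lift_definition supported_on :: "real set \<Rightarrow> L2 \<Rightarrow> bool" is
  "\<lambda>X f. AE x in lborel. x \<notin> X \<longrightarrow> f x = 0"
proof -
  fix X :: "real set" and f g :: "real \<Rightarrow> real"
  assume "square_integrable f \<and> square_integrable g \<and> (AE x in lborel. f x = g x)"
  then have "AE x in lborel. f x = g x" by simp
  then have "AE x in lborel. (x \<notin> X \<longrightarrow> f x = 0) = (x \<notin> X \<longrightarrow> g x = 0)"
    by eventually_elim simp
  then show "(AE x in lborel. x \<notin> X \<longrightarrow> f x = 0) = (AE x in lborel. x \<notin> X \<longrightarrow> g x = 0)"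
    by (rule eventually_subst)
qed

definition L2_on :: "real set \<Rightarrow> L2 set" where
  "L2_on X = {u. supported_on X u}"

definition dirichlet_ev :: "real \<Rightarrow> nat \<Rightarrow> real" where
  "dirichlet_ev L j = (pi * real j / L)\<^sup>2"

lemma square_integrable_sine:
  "square_integrable (\<lambda>x. indicator {0..L} x * (sqrt (2 / L) * sin (pi * real j * x / L)))"
proof -
  have "set_integrable lborel {0..L} (\<lambda>x. (sqrt (2 / L) * sin (pi * real j * x / L))\<^sup>2)"
    unfolding set_integrable_def
    unfolding divide_inverse by (intro borel_integrable_compact continuous_intros) auto
  moreover have "(\<lambda>x. (indicator {0..L} x * (sqrt (2 / L) * sin (pi * real j * x / L)))\<^sup>2) =
      (\<lambda>x. indicator {0..L} x *\<^sub>R (sqrt (2 / L) * sin (pi * real j * x / L))\<^sup>2)"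
    by (auto simp: indicator_def)
  ultimately show ?thesis
    unfolding square_integrable_def set_integrable_def by simp
qed

lift_definition dirichlet_ef :: "real \<Rightarrow> nat \<Rightarrow> L2" is
  "\<lambda>L j x. indicator {0..L} x * (sqrt (2 / L) * sin (pi * real j * x / L))"
  by (simp add: square_integrable_sine)

lemma dirichlet_ef_in_L2_on: "dirichlet_ef L j \<in> L2_on {0..L}"
  unfolding L2_on_def mem_Collect_eq by transfer (simp add: square_integrable_sine)

text \<open>
  Operators of a Hilbert space \<open>H\<close>, given as a closed subspace of a type, are pairs of a domain \<open>D\<close>
  and a function; values of the function outside \<open>D\<close> are irrelevant.
\<close>

definition linear_operator :: "'a::real_vector set \<Rightarrow> 'a set \<Rightarrow> ('a \<Rightarrow> 'a) \<Rightarrow> bool" where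
  "linear_operator H D T \<longleftrightarrow> subspace D \<and> D \<subseteq> H \<and> T ` D \<subseteq> H \<and>
     (\<forall>u\<in>D. \<forall>v\<in>D. T (u + v) = T u + T v) \<and> (\<forall>c. \<forall>u\<in>D. T (c *\<^sub>R u) = c *\<^sub>R T u)"

definition bounded_operator :: "'a::real_normed_vector set \<Rightarrow> ('a \<Rightarrow> 'a) \<Rightarrow> bool" where
  "bounded_operator H T \<longleftrightarrow> linear_operator H H T \<and> (\<exists>C. \<forall>u\<in>H. norm (T u) \<le> C * norm u)"

definition eigenpair :: "'a::real_vector set \<Rightarrow> ('a \<Rightarrow> 'a) \<Rightarrow> real \<Rightarrow> 'a \<Rightarrow> bool" where
  "eigenpair D T c u \<longleftrightarrow> u \<in> D \<and> u \<noteq> 0 \<and> T u = c *\<^sub>R u"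

definition adjoint_dom :: "'a::real_inner set \<Rightarrow> 'a set \<Rightarrow> ('a \<Rightarrow> 'a) \<Rightarrow> 'a set" where
  "adjoint_dom H D T = {v \<in> H. \<exists>w\<in>H. \<forall>u\<in>D. inner (T u) v = inner u w}"

definition adjoint_op :: "'a::real_inner set \<Rightarrow> 'a set \<Rightarrow> ('a \<Rightarrow> 'a) \<Rightarrow> 'a \<Rightarrow> 'a" where
  "adjoint_op H D T v = (THE w. w \<in> H \<and> (\<forall>u\<in>D. inner (T u) v = inner u w))"

definition self_adjoint :: "'a::real_inner set \<Rightarrow> 'a set \<Rightarrow> ('a \<Rightarrow> 'a) \<Rightarrow> bool" where
  "self_adjoint H D T \<longleftrightarrow> linear_operator H D T \<and> H \<subseteq> closure D \<and>
     adjoint_dom H D T = D \<and> (\<forall>v\<in>D. adjoint_op H D T v = T v)"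

definition orthonormal_basis :: "'a::real_inner set \<Rightarrow> (nat \<Rightarrow> 'a) \<Rightarrow> bool" where
  "orthonormal_basis H b \<longleftrightarrow>
     (\<forall>j\<ge>1. \<forall>k\<ge>1. inner (b j) (b k) = (if j = k then 1 else 0)) \<and>
     closure (span (b ` {1..})) = H"

definition C0_contraction_semigroup ::
  "'a::real_normed_vector set \<Rightarrow> (real \<Rightarrow> 'a \<Rightarrow> 'a) \<Rightarrow> bool" where
  "C0_contraction_semigroup H S \<longleftrightarrow>
     (\<forall>t\<ge>0. linear_operator H H (S t)) \<and>
     (\<forall>t\<ge>0. \<forall>u\<in>H. norm (S t u) \<le> norm u) \<and>
     (\<forall>u\<in>H. S 0 u = u) \<and>
     (\<forall>s\<ge>0. \<forall>t\<ge>0. \<forall>u\<in>H. S (s + t) u = S s (S t u)) \<and>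
     (\<forall>u\<in>H. ((\<lambda>t. S t u) \<longlongrightarrow> u) (at_right 0))"

definition is_generator ::
  "'a::real_normed_vector set \<Rightarrow> (real \<Rightarrow> 'a \<Rightarrow> 'a) \<Rightarrow> 'a set \<Rightarrow> ('a \<Rightarrow> 'a) \<Rightarrow> bool" where
  "is_generator H S D T \<longleftrightarrow>
     D = {u \<in> H. \<exists>v\<in>H. ((\<lambda>t. (S t u - u) /\<^sub>R t) \<longlongrightarrow> v) (at_right 0)} \<and>
     (\<forall>u\<in>D. ((\<lambda>t. (S t u - u) /\<^sub>R t) \<longlongrightarrow> T u) (at_right 0))"

text \<open>
  In the following two definitions \<open>S s\<close> plays the role of \<open>e\<^bsup>As\<^esup>\<close>. The operator-valued integral
  and the limit are both taken in the strong sense, that is, applied to a vector \<open>u\<close>.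
\<close>

definition covariance_op ::
  "'a::real_inner set \<Rightarrow> real \<Rightarrow> (real \<Rightarrow> 'a \<Rightarrow> 'a) \<Rightarrow> ('a \<Rightarrow> 'a) \<Rightarrow> real \<Rightarrow> 'a \<Rightarrow> 'a" where
  "covariance_op H \<sigma> S Q t u =
     \<sigma>\<^sup>2 *\<^sub>R integral {0..t} (\<lambda>s. S s (Q (adjoint_op H H (S s) u)))"

definition covariance_op_inf ::
  "'a::real_inner set \<Rightarrow> real \<Rightarrow> (real \<Rightarrow> 'a \<Rightarrow> 'a) \<Rightarrow> ('a \<Rightarrow> 'a) \<Rightarrow> 'a \<Rightarrow> 'a" where
  "covariance_op_inf H \<sigma> S Q u = Lim at_top (\<lambda>t. covariance_op H \<sigma> S Q t u)"

end

theory Submission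
  imports Defs
begin

text \<open>
  Let \<open>T = A + \<alpha>\<close> and \<open>\<mu>\<^sub>j = \<lambda>\<^sub>j - \<alpha> > 0\<close>, so that \<open>T e\<^sub>j = - \<mu>\<^sub>j e\<^sub>j\<close>. The idea is that the
  semigroup sees an eigenvector only through a scalar: \<open>\<langle>S s u, e\<^sub>j\<rangle> = exp (- \<mu>\<^sub>j s) \<langle>u, e\<^sub>j\<rangle>\<close> for
  every \<open>u\<close> (\<open>semigroup_inner_eigenvector\<close>), which follows from the differential equation of the
  orbit \<open>S s u\<close> and the symmetry of \<open>T\<close>. Hence \<open>(S s)\<^sup>* e\<^sub>j = exp (- \<mu>\<^sub>j s) e\<^sub>j\<close>, and the integrand
  of the covariance operator at \<open>e\<^sub>i\<close> is \<open>exp (- \<mu>\<^sub>i s) S s (Q e\<^sub>i)\<close>. Its norm is at most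
  \<open>exp (- \<mu>\<^sub>i s) \<parallel>Q e\<^sub>i\<parallel>\<close>, so the integral over \<open>[0, t]\<close> converges in norm as \<open>t \<rightarrow> \<infinity>\<close>
  (\<open>damped_integral_converges\<close>), and pairing the limit with \<open>e\<^sub>j\<close> gives
  \<open>\<sigma>\<^sup>2 \<langle>Q e\<^sub>i, e\<^sub>j\<rangle> \<integral> exp (- (\<mu>\<^sub>i + \<mu>\<^sub>j) s) ds = \<sigma>\<^sup>2 \<langle>Q e\<^sub>i, e\<^sub>j\<rangle> / (\<mu>\<^sub>i + \<mu>\<^sub>j)\<close>
  (\<open>covariance_op_inf_eigenvectors\<close>).

  It remains to expand \<open>\<langle>Q e\<^sub>i, e\<^sub>j\<rangle>\<close> in the basis that diagonalizes \<open>Q\<close>: expanding \<open>e\<^sub>j\<close> and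
  using \<open>\<langle>Q e\<^sub>i, b\<^sub>n\<rangle> = \<langle>e\<^sub>i, Q b\<^sub>n\<rangle> = q\<^sub>n \<langle>e\<^sub>i, b\<^sub>n\<rangle>\<close> produces the series in the statement, with its
  convergence (\<open>diagonal_operator_sums\<close>).
\<close>

section \<open>Adjoints\<close>

text \<open>
  By density the difference \<open>w - w'\<close> is orthogonal to all of \<open>H\<close>, in particular to \<open>w\<close> and to \<open>w'\<close>,
  and therefore to itself. This is what makes the description of \<open>adjoint_op\<close> single-valued.
\<close>

lemma inner_dense_unique:
  fixes w w' :: "'a::real_inner"
  assumes dense: "H \<subseteq> closure D" and "w \<in> H" "w' \<in> H"
    and eq: "\<And>u. u \<in> D \<Longrightarrow> inner u w = inner u w'"
  shows "w = w'"
proof -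
  have "closed {u. inner u (w - w') = 0}"
    by (intro closed_Collect_eq continuous_intros)
  moreover have "D \<subseteq> {u. inner u (w - w') = 0}"
    using eq by (auto simp: inner_diff_right)
  ultimately have "H \<subseteq> {u. inner u (w - w') = 0}"
    using closure_minimal dense by blast
  then have "inner w (w - w') = 0" "inner w' (w - w') = 0"
    using assms(2,3) by auto
  then have "inner (w - w') (w - w') = 0"
    by (simp add: inner_diff_left)
  then show ?thesis by simp
qed

lemma adjoint_op_eqI:
  fixes w :: "'a::real_inner"
  assumes "H \<subseteq> closure D" "w \<in> H" and w: "\<And>u. u \<in> D \<Longrightarrow> inner (T u) v = inner u w"
  shows "adjoint_op H D T v = w"
  unfolding adjoint_op_def
proof (rule the_equality)
  show "w \<in> H \<and> (\<forall>u\<in>D. inner (T u) v = inner u w)"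
    using assms by blast
next
  fix w' assume "w' \<in> H \<and> (\<forall>u\<in>D. inner (T u) v = inner u w')"
  then show "w' = w"
    using assms by (intro inner_dense_unique[OF assms(1)]) auto
qed

lemma self_adjoint_symmetric:
  fixes u v :: "'a::real_inner"
  assumes sa: "self_adjoint H D T" and "u \<in> D" "v \<in> D"
  shows "inner (T u) v = inner u (T v)"
proof -
  have dense: "H \<subseteq> closure D" and "adjoint_op H D T v = T v" and "v \<in> adjoint_dom H D T"
    using assms by (auto simp: self_adjoint_def)
  moreover obtain w where "w \<in> H" and w: "\<And>u. u \<in> D \<Longrightarrow> inner (T u) v = inner u w"
    using \<open>v \<in> adjoint_dom H D T\<close> unfolding adjoint_dom_def by blast
  moreover have "adjoint_op H D T v = w"
    using dense \<open>w \<in> H\<close> w by (rule adjoint_op_eqI)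
  ultimately show ?thesis using \<open>u \<in> D\<close> by simp
qed

section \<open>Orbits of a contraction semigroup\<close>

lemma linear_operator_diff:
  assumes "linear_operator H D T" "u \<in> D" "v \<in> D"
  shows "T (u - v) = T u - T v"
proof -
  have "- v \<in> D" and neg: "T (- v) = - T v"
    using assms unfolding linear_operator_def
    by (auto simp: subspace_neg dest!: spec[of _ "-1"])
  then have "T (u + - v) = T u + T (- v)"
    using assms unfolding linear_operator_def by blast
  then show ?thesis by (simp add: neg)
qed

context
  fixes H :: "'a::real_normed_vector set" and S :: "real \<Rightarrow> 'a \<Rightarrow> 'a"
  assumes semigroup: "C0_contraction_semigroup H S"
begin

lemma semigroup_linear: "t \<ge> 0 \<Longrightarrow> linear_operator H H (S t)"
  and semigroup_contraction: "t \<ge> 0 \<Longrightarrow> u \<in> H \<Longrightarrow> norm (S t u) \<le> norm u"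
  and semigroup_0: "u \<in> H \<Longrightarrow> S 0 u = u"
  and semigroup_add: "s \<ge> 0 \<Longrightarrow> t \<ge> 0 \<Longrightarrow> u \<in> H \<Longrightarrow> S (s + t) u = S s (S t u)"
  and semigroup_right_continuous_0: "u \<in> H \<Longrightarrow> ((\<lambda>t. S t u) \<longlongrightarrow> u) (at_right 0)"
  using semigroup unfolding C0_contraction_semigroup_def by auto

lemma semigroup_subspace: "subspace H"
  using semigroup_linear[of 0] by (simp add: linear_operator_def)

lemma semigroup_closed: "t \<ge> 0 \<Longrightarrow> u \<in> H \<Longrightarrow> S t u \<in> H"
  using semigroup_linear[of t] by (auto simp: linear_operator_def)

lemma semigroup_scale: "t \<ge> 0 \<Longrightarrow> u \<in> H \<Longrightarrow> S t (c *\<^sub>R u) = c *\<^sub>R S t u"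
  using semigroup_linear[of t] by (auto simp: linear_operator_def)

lemma semigroup_diff: "t \<ge> 0 \<Longrightarrow> u \<in> H \<Longrightarrow> v \<in> H \<Longrightarrow> S t (u - v) = S t u - S t v"
  using linear_operator_diff[OF semigroup_linear] .

text \<open>
  Writing \<open>S t u - S s u = S s (S (t - s) u - u)\<close> for \<open>s \<le> t\<close>, the contraction property bounds
  every increment of an orbit by an increment starting at time \<open>0\<close>. Continuity on the right at
  \<open>0\<close> therefore gives two-sided continuity at all times.
\<close>

lemma semigroup_increment:
  assumes "0 \<le> s" "0 \<le> t" "u \<in> H"
  shows "norm (S t u - S s u) \<le> norm (S \<bar>t - s\<bar> u - u)"
proof -
  have *: "norm (S t u - S s u) \<le> norm (S (t - s) u - u)" if "0 \<le> s" "s \<le> t" for s t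
  proof -
    have "S t u - S s u = S s (S (t - s) u - u)"
      using that assms(3) semigroup_add[of s "t - s" u]
      by (simp add: semigroup_diff semigroup_closed)
    then show ?thesis
      using that assms(3)
      by (metis semigroup_contraction semigroup_closed subspace_diff[OF semigroup_subspace]
          diff_ge_0_iff_ge)
  qed
  show ?thesis
    using *[of s t] *[of t s] assms by (cases "s \<le> t") (auto simp: norm_minus_commute)
qed

lemma semigroup_continuous_on:
  assumes "u \<in> H"
  shows "continuous_on {0..} (\<lambda>t. S t u)"
  unfolding continuous_on_iff
proof (intro ballI allI impI)
  fix s \<epsilon> :: real assume "s \<in> {0..}" "\<epsilon> > 0"
  obtain d where "d > 0" and d: "\<And>h. 0 < h \<Longrightarrow> h < d \<Longrightarrow> dist (S h u) u < \<epsilon>"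
    using tendstoD[OF semigroup_right_continuous_0[OF assms] \<open>\<epsilon> > 0\<close>]
    by (auto simp: eventually_at_right_field)
  have "dist (S t u) (S s u) < \<epsilon>" if "t \<in> {0..}" "dist t s < d" for t
  proof (cases "t = s")
    case False
    then show ?thesis
      using semigroup_increment[of s t u] d[of "\<bar>t - s\<bar>"] that \<open>s \<in> {0..}\<close> assms
      by (simp add: dist_norm)
  qed (use \<open>\<epsilon> > 0\<close> in simp)
  then show "\<exists>d>0. \<forall>t\<in>{0..}. dist t s < d \<longrightarrow> dist (S t u) (S s u) < \<epsilon>"
    using \<open>d > 0\<close> by blast
qed

context
  fixes D :: "'a set" and T :: "'a \<Rightarrow> 'a"
  assumes generator: "is_generator H S D T"
begin

lemma generator_subset: "D \<subseteq> H"
  and generator_tendsto: "u \<in> D \<Longrightarrow> ((\<lambda>h. (S h u - u) /\<^sub>R h) \<longlongrightarrow> T u) (at_right 0)"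
  and generator_domI: "u \<in> H \<Longrightarrow> v \<in> H \<Longrightarrow> ((\<lambda>h. (S h u - u) /\<^sub>R h) \<longlongrightarrow> v) (at_right 0) \<Longrightarrow> u \<in> D"
  using generator unfolding is_generator_def by blast+

lemma generator_in:
  assumes "u \<in> D"
  shows "T u \<in> H"
proof -
  obtain v where "v \<in> H" "((\<lambda>h. (S h u - u) /\<^sub>R h) \<longlongrightarrow> v) (at_right 0)"
    using assms generator unfolding is_generator_def by blast
  then show ?thesis
    using tendsto_unique[OF trivial_limit_at_right_real] generator_tendsto[OF assms] by metis
qed

text \<open>
  The error of the difference quotient at time \<open>t\<close> is the image under \<open>S t\<close> of the error at time
  \<open>0\<close>, so by contractivity it is no larger.
\<close>

lemma semigroup_quotient_error:
  assumes "t \<ge> 0" "h > 0" "u \<in> D"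
  shows "norm ((S (t + h) u - S t u) /\<^sub>R h - S t (T u)) \<le> norm ((S h u - u) /\<^sub>R h - T u)"
proof -
  have "u \<in> H" "T u \<in> H" "S h u \<in> H"
    using assms generator_subset generator_in semigroup_closed by auto
  note sub = subspace_diff[OF semigroup_subspace] subspace_scale[OF semigroup_subspace]
  have "(S (t + h) u - S t u) /\<^sub>R h - S t (T u) = S t ((S h u - u) /\<^sub>R h - T u)"
    using assms \<open>u \<in> H\<close> \<open>T u \<in> H\<close> \<open>S h u \<in> H\<close>
    by (simp add: semigroup_add semigroup_diff semigroup_scale sub)
  also have "norm \<dots> \<le> norm ((S h u - u) /\<^sub>R h - T u)"
    using assms \<open>u \<in> H\<close> \<open>T u \<in> H\<close> \<open>S h u \<in> H\<close> by (intro semigroup_contraction sub) auto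
  finally show ?thesis .
qed

lemma semigroup_generator_commute:
  assumes "t \<ge> 0" "u \<in> D"
  shows "S t u \<in> D" and "T (S t u) = S t (T u)"
proof -
  have "u \<in> H" "T u \<in> H" "S t (T u) \<in> H"
    using assms generator_subset generator_in semigroup_closed by auto
  have "((\<lambda>h. norm ((S h u - u) /\<^sub>R h - T u)) \<longlongrightarrow> 0) (at_right 0)"
    using tendsto_norm[OF LIM_zero[OF generator_tendsto[OF assms(2)]]] by simp
  moreover have "\<forall>\<^sub>F h in at_right 0. norm ((S h (S t u) - S t u) /\<^sub>R h - S t (T u))
      \<le> norm ((S h u - u) /\<^sub>R h - T u)"
    using eventually_at_right_less[of 0]
  proof eventually_elim
    case (elim h)
    then show ?case
      using semigroup_quotient_error[OF assms(1) elim assms(2)] semigroup_add[of h t u]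
        assms \<open>u \<in> H\<close> by (simp add: add.commute)
  qed
  ultimately have "((\<lambda>h. (S h (S t u) - S t u) /\<^sub>R h - S t (T u)) \<longlongrightarrow> 0) (at_right 0)"
    by (rule Lim_null_comparison[rotated])
  then have lim: "((\<lambda>h. (S h (S t u) - S t u) /\<^sub>R h) \<longlongrightarrow> S t (T u)) (at_right 0)"
    by (simp add: LIM_zero_iff)
  then show "S t u \<in> D"
    using \<open>u \<in> H\<close> \<open>S t (T u) \<in> H\<close> assms(1) by (intro generator_domI semigroup_closed) auto
  then show "T (S t u) = S t (T u)"
    using tendsto_unique[OF trivial_limit_at_right_real generator_tendsto lim] by blast
qed

text \<open>
  The generator only describes derivatives from the right. For an increment to the left, from \<open>t\<close>
  down to \<open>y\<close>, the quotient is compared with the derivative at the earlier time \<open>y\<close>, and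
  continuity of \<open>s \<mapsto> S s (T u)\<close> moves that derivative to \<open>t\<close>.
\<close>

lemma semigroup_has_vector_derivative:
  assumes "t \<ge> 0" "u \<in> D"
  shows "((\<lambda>t. S t u) has_vector_derivative S t (T u)) (at t within {0..})"
  unfolding has_vector_derivative_def has_derivative_within_alt
proof (intro conjI allI impI)
  show "bounded_linear (\<lambda>x. x *\<^sub>R S t (T u))"
    by (rule bounded_linear_scaleR_left)
next
  fix \<epsilon> :: real assume "\<epsilon> > 0"
  then have "\<epsilon> / 2 > 0" by simp
  obtain d where "d > 0"
    and d: "\<And>h. 0 < h \<Longrightarrow> h < d \<Longrightarrow> norm ((S h u - u) /\<^sub>R h - T u) < \<epsilon> / 2"
    using tendstoD[OF generator_tendsto[OF assms(2)] \<open>\<epsilon> / 2 > 0\<close>]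
    by (auto simp: eventually_at_right_field dist_norm)
  obtain d' where "d' > 0"
    and d': "\<And>y. 0 \<le> y \<Longrightarrow> \<bar>y - t\<bar> < d' \<Longrightarrow> norm (S y (T u) - S t (T u)) < \<epsilon> / 2"
  proof -
    have "t \<in> {0..}" using assms(1) by simp
    with semigroup_continuous_on[OF generator_in[OF assms(2)]] \<open>\<epsilon> / 2 > 0\<close>
    obtain d' where "d' > 0"
      "\<forall>y\<in>{0..}. dist y t < d' \<longrightarrow> dist (S y (T u)) (S t (T u)) < \<epsilon> / 2"
      unfolding continuous_on_iff by blast
    then show ?thesis using that[of d'] by (simp add: dist_norm)
  qed
  have forward: "norm (S (s + h) u - S s u - h *\<^sub>R S s (T u)) \<le> \<epsilon> / 2 * h"
    if "s \<ge> 0" "0 < h" "h < d" for s h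
  proof -
    have "S (s + h) u - S s u - h *\<^sub>R S s (T u)
        = h *\<^sub>R ((S (s + h) u - S s u) /\<^sub>R h - S s (T u))"
      using that by (simp add: scaleR_diff_right)
    also have "norm \<dots> = h * norm ((S (s + h) u - S s u) /\<^sub>R h - S s (T u))"
      using that by simp
    also have "\<dots> \<le> h * (\<epsilon> / 2)"
      using that assms(2) semigroup_quotient_error[of s h u] d[of h]
      by (intro mult_left_mono) auto
    finally show ?thesis by (simp add: mult.commute)
  qed
  have "norm (S y u - S t u - (y - t) *\<^sub>R S t (T u)) \<le> \<epsilon> * norm (y - t)"
    if y: "y \<in> {0..}" "norm (y - t) < min d d'" for y
  proof -
    consider "y = t" | "t < y" | "y < t" by linarith
    then show ?thesis
    proof cases
      case 2
      then have "norm (S y u - S t u - (y - t) *\<^sub>R S t (T u)) \<le> \<epsilon> / 2 * (y - t)"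
        using forward[of t "y - t"] y assms(1) by simp
      also have "\<dots> \<le> \<epsilon> * norm (y - t)"
        using 2 \<open>\<epsilon> > 0\<close> by simp
      finally show ?thesis .
    next
      case 3
      have "S y u - S t u - (y - t) *\<^sub>R S t (T u)
          = - (S t u - S y u - (t - y) *\<^sub>R S y (T u)) - (t - y) *\<^sub>R (S y (T u) - S t (T u))"
        by (simp add: algebra_simps)
      also have "norm \<dots> \<le> norm (S t u - S y u - (t - y) *\<^sub>R S y (T u))
          + norm ((t - y) *\<^sub>R (S y (T u) - S t (T u)))"
        using norm_triangle_ineq4 by (metis norm_minus_cancel)
      also have "\<dots> \<le> \<epsilon> / 2 * (t - y) + (t - y) * (\<epsilon> / 2)"
        using 3 y forward[of y "t - y"] d'[of y]
        by (intro add_mono) (auto intro!: mult_left_mono)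
      also have "\<dots> = \<epsilon> * norm (y - t)"
        using 3 by simp
      finally show ?thesis .
    qed simp
  qed
  then show "\<exists>d>0. \<forall>y\<in>{0..}. norm (y - t) < d \<longrightarrow>
      norm (S y u - S t u - (y - t) *\<^sub>R S t (T u)) \<le> \<epsilon> * norm (y - t)"
    using \<open>d > 0\<close> \<open>d' > 0\<close> by (intro exI[of _ "min d d'"]) auto
qed

end

end

section \<open>The adjoint semigroup on an eigenvector of the generator\<close>

text \<open>
  For \<open>u\<close> in the domain, \<open>\<phi> t = \<langle>S t u, v\<rangle>\<close> solves \<open>\<phi>' = \<langle>T (S t u), v\<rangle> = \<langle>S t u, T v\<rangle> = - \<mu> \<phi>\<close>,
  because \<open>T\<close> is symmetric. Density of the domain and contractivity extend the resulting formula
  to all \<open>u\<close>, which is what determines the adjoint of \<open>S t\<close> at \<open>v\<close>.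
\<close>

lemma semigroup_inner_eigenvector:
  fixes H :: "'a::real_inner set"
  assumes S: "C0_contraction_semigroup H S" and gen: "is_generator H S D T"
    and sa: "self_adjoint H D T" and v: "eigenpair D T (- \<mu>) v" and "t \<ge> 0" "u \<in> H"
  shows "inner (S t u) v = exp (- (\<mu> * t)) * inner u v"
proof -
  have "v \<in> D" and Tv: "T v = (- \<mu>) *\<^sub>R v"
    using v by (auto simp: eigenpair_def)
  have dom: "inner (S t u) v = exp (- (\<mu> * t)) * inner u v" if "u \<in> D" for u
  proof -
    have "u \<in> H" using that generator_subset[OF S gen] by blast
    define \<psi> where "\<psi> t = exp (\<mu> * t) * inner (S t u) v" for t
    have "(\<psi> has_vector_derivative 0) (at s within {0..})" if "s \<in> {0..}" for s
    proof -
      have "inner (S s (T u)) v = inner (S s u) (T v)"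
        using semigroup_generator_commute[OF S gen, of s u] self_adjoint_symmetric[OF sa]
          that \<open>u \<in> D\<close> \<open>v \<in> D\<close> by fastforce
      moreover have "((\<lambda>t. inner (S t u) v) has_vector_derivative inner (S s (T u)) v)
          (at s within {0..})"
        using semigroup_has_vector_derivative[OF S gen] that \<open>u \<in> D\<close>
        by (intro bounded_linear.has_vector_derivative[OF bounded_linear_inner_left]) auto
      ultimately have "((\<lambda>t. inner (S t u) v) has_real_derivative - \<mu> * inner (S s u) v)
          (at s within {0..})"
        by (simp add: Tv has_real_derivative_iff_has_vector_derivative)
      then have "(\<psi> has_real_derivative
          exp (\<mu> * s) * (- \<mu> * inner (S s u) v) + \<mu> * exp (\<mu> * s) * inner (S s u) v)
          (at s within {0..})"
        unfolding \<psi>_def by (auto intro!: derivative_eq_intros)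
      then show ?thesis
        by (simp add: has_real_derivative_iff_has_vector_derivative algebra_simps)
    qed
    then obtain c where "\<And>s. s \<in> {0..} \<Longrightarrow> \<psi> s = c"
      using has_vector_derivative_zero_constant[of "{0..}" \<psi>] by auto
    then have "\<psi> t = \<psi> 0" using \<open>t \<ge> 0\<close> by auto
    then show ?thesis
      using \<open>u \<in> H\<close> by (simp add: \<psi>_def semigroup_0[OF S] exp_minus field_simps)
  qed
  have "H \<subseteq> closure D" using sa by (simp add: self_adjoint_def)
  then obtain x where xD: "\<And>n::nat. x n \<in> D" and x: "x \<longlonglongrightarrow> u"
    using \<open>u \<in> H\<close> closure_sequential[of u D] by auto
  have xH: "x n \<in> H" for n using xD generator_subset[OF S gen] by blast
  have "(\<lambda>n. S t (x n)) \<longlonglongrightarrow> S t u"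
  proof (rule LIM_zero_cancel, rule Lim_null_comparison)
    show "\<forall>\<^sub>F n in sequentially. norm (S t (x n) - S t u) \<le> norm (x n - u)"
      using semigroup_contraction[OF S \<open>t \<ge> 0\<close>] semigroup_diff[OF S \<open>t \<ge> 0\<close>] xH \<open>u \<in> H\<close>
        subspace_diff[OF semigroup_subspace[OF S]] by (metis (no_types, lifting) eventuallyI)
    show "(\<lambda>n. norm (x n - u)) \<longlonglongrightarrow> 0"
      using x by (simp add: LIM_zero tendsto_norm_zero)
  qed
  then have "(\<lambda>n. inner (S t (x n)) v) \<longlonglongrightarrow> inner (S t u) v"
    by (intro tendsto_intros)
  moreover have "(\<lambda>n. exp (- (\<mu> * t)) * inner (x n) v) \<longlonglongrightarrow> exp (- (\<mu> * t)) * inner u v"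
    using x by (intro tendsto_intros)
  ultimately show ?thesis
    unfolding dom[OF xD] by (rule LIMSEQ_unique)
qed

lemma semigroup_adjoint_eigenvector:
  fixes H :: "'a::real_inner set"
  assumes S: "C0_contraction_semigroup H S" and gen: "is_generator H S D T"
    and sa: "self_adjoint H D T" and v: "eigenpair D T (- \<mu>) v" and "t \<ge> 0"
  shows "adjoint_op H H (S t) v = exp (- (\<mu> * t)) *\<^sub>R v"
proof (rule adjoint_op_eqI)
  have "v \<in> H" using v generator_subset[OF S gen] by (auto simp: eigenpair_def)
  then show "exp (- (\<mu> * t)) *\<^sub>R v \<in> H"
    by (rule subspace_scale[OF semigroup_subspace[OF S]])
qed (use semigroup_inner_eigenvector[OF assms] closure_subset in auto)

section \<open>Orthonormal expansions\<close>

text \<open>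
  The partial sums of the expansion are contractions (Bessel) and
  eventually fix each vector of the span, so they converge to the identity on its closure.
\<close>

lemma orthonormal_basis_expansion:
  fixes H :: "'a::real_inner set"
  assumes b: "orthonormal_basis H b" and "u \<in> H"
  shows "(\<lambda>n. inner u (b (Suc n)) *\<^sub>R b (Suc n)) sums u"
proof -
  have orth: "inner (b (Suc j)) (b (Suc k)) = (if j = k then 1 else 0)" for j k
    using b by (auto simp: orthonormal_basis_def)
  define P where "P n v = (\<Sum>k<n. inner v (b (Suc k)) *\<^sub>R b (Suc k))" for n v
  have P_add: "P n (v + w) = P n v + P n w" for n v w
    by (simp add: P_def inner_add_left scaleR_add_left sum.distrib)
  have P_scale: "P n (c *\<^sub>R v) = c *\<^sub>R P n v" for n c v
    by (simp add: P_def scaleR_sum_right)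
  have P_diff: "P n (v - w) = P n v - P n w" for n v w
    by (simp add: P_def inner_diff_left scaleR_diff_left sum_subtractf)
  have P_basis: "P n (b (Suc k)) = b (Suc k)" if "k < n" for n k
  proof -
    have "P n (b (Suc k)) = (\<Sum>j<n. if j = k then b (Suc k) else 0)"
      unfolding P_def by (intro sum.cong) (auto simp: orth)
    then show ?thesis using that by simp
  qed
  have P_bound: "norm (P n v) \<le> norm v" for n v
  proof -
    have "inner (P n v) (b (Suc k)) = inner v (b (Suc k))" if "k < n" for k
      using that by (simp add: P_def inner_sum_left orth if_distrib cong: if_cong)
    then have "inner (P n v) (P n v) = (\<Sum>k<n. inner v (b (Suc k)) * inner v (b (Suc k)))"
      by (subst (2) P_def) (simp add: inner_sum_right)
    also have "\<dots> = inner (P n v) v"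
      by (simp add: P_def inner_sum_left inner_commute[of v])
    also have "\<dots> \<le> norm (P n v) * norm v"
      by (rule norm_cauchy_schwarz)
    finally have "norm (P n v) * norm (P n v) \<le> norm (P n v) * norm v"
      by (simp add: dot_square_norm power2_eq_square)
    then show ?thesis
      by (cases "P n v = 0") auto
  qed
  have fixed: "\<exists>N. \<forall>n\<ge>N. P n w = w" if "w \<in> span (b ` {1..})" for w
    using that
  proof (induction rule: span_induct_alt)
    case base
    then show ?case by (simp add: P_def)
  next
    case (step c x y)
    obtain k where "x = b (Suc k)"
      using step by (metis Suc_pred' atLeast_iff imageE less_eq_Suc_le One_nat_def)
    moreover obtain N where "\<forall>n\<ge>N. P n y = y" using step by blast
    ultimately have "\<forall>n\<ge>max N (Suc k). P n (c *\<^sub>R x + y) = c *\<^sub>R x + y"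
      by (simp add: P_add P_scale P_basis)
    then show ?case by blast
  qed
  have "(\<lambda>n. P n u) \<longlonglongrightarrow> u"
  proof (rule LIMSEQ_I)
    fix \<epsilon> :: real assume "\<epsilon> > 0"
    then have "\<epsilon> / 2 > 0" by simp
    have "u \<in> closure (span (b ` {1..}))"
      using b \<open>u \<in> H\<close> by (simp add: orthonormal_basis_def)
    then obtain w where w: "w \<in> span (b ` {1..})" "dist w u < \<epsilon> / 2"
      using \<open>\<epsilon> / 2 > 0\<close> unfolding closure_approachable by blast
    obtain N where N: "\<And>n. n \<ge> N \<Longrightarrow> P n w = w" using fixed[OF w(1)] by blast
    have "norm (P n u - u) < \<epsilon>" if "n \<ge> N" for n
    proof -
      have "P n u - u = (w - u) - P n (w - u)"
        using N[OF that] by (simp add: P_diff)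
      then have "norm (P n u - u) \<le> norm (w - u) + norm (P n (w - u))"
        by (metis norm_triangle_ineq4)
      also have "\<dots> < \<epsilon>"
        using P_bound[of n "w - u"] w(2) by (simp add: dist_norm)
      finally show ?thesis .
    qed
    then show "\<exists>N. \<forall>n\<ge>N. norm (P n u - u) < \<epsilon>" by blast
  qed
  then show ?thesis by (simp add: sums_def P_def)
qed

text \<open>
  Only \<open>v\<close> is expanded; continuity of \<open>\<langle>Q u, \<cdot>\<rangle>\<close> then turns convergence of the expansion into
  convergence of the series, and symmetry of \<open>Q\<close> moves it onto the eigenvectors.
\<close>

lemma diagonal_operator_sums:
  fixes H :: "'a::real_inner set"
  assumes b: "orthonormal_basis H b" and sa: "self_adjoint H H Q"
    and Qb: "\<forall>k\<ge>1. eigenpair H Q (q k) (b k)" and "u \<in> H" "v \<in> H"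
  shows "(\<lambda>n. q (Suc n) * inner u (b (Suc n)) * inner v (b (Suc n))) sums inner (Q u) v"
proof -
  have "inner (Q u) (b (Suc n)) = q (Suc n) * inner u (b (Suc n))" for n
    using self_adjoint_symmetric[OF sa \<open>u \<in> H\<close>, of "b (Suc n)"] Qb
    by (simp add: eigenpair_def)
  moreover have "(\<lambda>n. inner (Q u) (inner v (b (Suc n)) *\<^sub>R b (Suc n))) sums inner (Q u) v"
    using orthonormal_basis_expansion[OF b \<open>v \<in> H\<close>]
    by (rule bounded_linear.sums[OF bounded_linear_inner_right])
  ultimately show ?thesis by (simp add: mult_ac)
qed

section \<open>Exponentially damped integrals\<close>

lemma exp_damped_integral:
  fixes \<mu> a t :: real
  assumes "\<mu> > 0" "a \<le> t"
  shows "((\<lambda>s. exp (- (\<mu> * s))) has_integral (exp (- (\<mu> * a)) - exp (- (\<mu> * t))) / \<mu>) {a..t}"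
proof -
  have "((\<lambda>s. exp (- (\<mu> * s))) has_integral
      (- (exp (- (\<mu> * t)) / \<mu>)) - (- (exp (- (\<mu> * a)) / \<mu>))) {a..t}"
    using assms
    by (intro fundamental_theorem_of_calculus)
      (auto intro!: derivative_eq_intros
        simp flip: has_real_derivative_iff_has_vector_derivative)
  then show ?thesis by (simp add: diff_divide_distrib)
qed

lemma exp_damped_tendsto:
  fixes \<mu> :: real
  assumes "\<mu> > 0"
  shows "((\<lambda>t. exp (- (\<mu> * t))) \<longlongrightarrow> 0) at_top"
  by (rule filterlim_compose[OF exp_at_bot])
    (use assms in \<open>auto simp: filterlim_uminus_at_bot
      intro: filterlim_tendsto_pos_mult_at_top filterlim_ident\<close>)

text \<open>
  The increment of the integral over \<open>[a, t]\<close> is at most \<open>C \<integral> exp (- \<mu> s) ds \<le> (C / \<mu>) exp (- \<mu> a)\<close>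
  uniformly in \<open>t\<close>, so the integrals are Cauchy as \<open>t \<rightarrow> \<infinity>\<close>.
\<close>

lemma damped_integral_converges:
  fixes f :: "real \<Rightarrow> 'a::banach"
  assumes "\<mu> > 0" and cont: "continuous_on {0..} f" and bound: "\<And>s. s \<ge> 0 \<Longrightarrow> norm (f s) \<le> C"
  obtains l where "((\<lambda>t. integral {0..t} (\<lambda>s. exp (- (\<mu> * s)) *\<^sub>R f s)) \<longlongrightarrow> l) at_top"
proof -
  define g where "g s = exp (- (\<mu> * s)) *\<^sub>R f s" for s
  define F where "F t = integral {0..t} g" for t
  have "C \<ge> 0" using bound[of 0] norm_ge_zero[of "f 0"] by linarith
  have int: "g integrable_on {a..t}" if "a \<ge> 0" for a t
    unfolding g_def using that
    by (intro integrable_continuous_interval continuous_intros continuous_on_subset[OF cont]) auto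
  have tail: "norm (F t - F a) \<le> C / \<mu> * exp (- (\<mu> * a))" if "0 \<le> a" "a \<le> t" for a t
  proof -
    have E: "((\<lambda>s. C * exp (- (\<mu> * s))) has_integral
        C * ((exp (- (\<mu> * a)) - exp (- (\<mu> * t))) / \<mu>)) {a..t}"
      using exp_damped_integral[OF \<open>\<mu> > 0\<close> \<open>a \<le> t\<close>] by (rule has_integral_mult_right)
    have "F a + integral {a..t} g = F t"
      unfolding F_def using that int by (intro Henstock_Kurzweil_Integration.integral_combine) auto
    then have "F t - F a = integral {a..t} g" by (simp add: algebra_simps)
    also have "norm \<dots> \<le> integral {a..t} (\<lambda>s. C * exp (- (\<mu> * s)))"
    proof (rule integral_norm_bound_integral[OF int[OF \<open>0 \<le> a\<close>]])
      show "(\<lambda>s. C * exp (- (\<mu> * s))) integrable_on {a..t}"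
        using E by blast
      show "norm (g s) \<le> C * exp (- (\<mu> * s))" if "s \<in> {a..t}" for s
        using bound[of s] that \<open>0 \<le> a\<close> by (simp add: g_def mult.commute)
    qed
    also have "\<dots> = C * ((exp (- (\<mu> * a)) - exp (- (\<mu> * t))) / \<mu>)"
      using E by (rule integral_unique)
    also have "\<dots> \<le> C / \<mu> * exp (- (\<mu> * a))"
      using \<open>C \<ge> 0\<close> \<open>\<mu> > 0\<close> by (simp add: divide_right_mono mult_left_mono)
    finally show ?thesis .
  qed
  have small: "\<forall>\<^sub>F a in at_top. C / \<mu> * exp (- (\<mu> * a)) < \<epsilon>" if "\<epsilon> > 0" for \<epsilon>
    using order_tendstoD(2)[OF tendsto_mult_right_zero[OF exp_damped_tendsto[OF \<open>\<mu> > 0\<close>]] that] .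
  have "cauchy_filter (filtermap F at_top)"
    unfolding cauchy_filter_metric_filtermap
  proof (intro allI impI)
    fix \<epsilon> :: real assume "\<epsilon> > 0"
    obtain a where "a \<ge> 0" and a: "\<And>t. t \<ge> a \<Longrightarrow> C / \<mu> * exp (- (\<mu> * t)) < \<epsilon>"
      using small[OF \<open>\<epsilon> > 0\<close>] unfolding eventually_at_top_linorder
      by (metis max.bounded_iff max.cobounded1 max.cobounded2)
    have *: "dist (F t) (F s) < \<epsilon>" if "a \<le> s" "s \<le> t" for s t
      using tail[of s t] a[of s] that \<open>a \<ge> 0\<close> by (simp add: dist_norm)
    have "dist (F s) (F t) < \<epsilon>" if "a \<le> s" "a \<le> t" for s t
      using *[of s t] *[of t s] that by (metis dist_commute linear)
    then show "\<exists>P. eventually P at_top \<and> (\<forall>x y. P x \<and> P y \<longrightarrow> dist (F x) (F y) < \<epsilon>)"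
      using eventually_ge_at_top[of a] by blast
  qed
  \<comment> \<open>Completeness is used for the filter of tails of \<open>F\<close>, since the limit is over real \<open>t\<close>.\<close>
  then obtain l where "filtermap F at_top \<le> nhds l"
    using complete_UNIV unfolding complete_uniform
    by (metis filtermap_bot_iff iso_tuple_UNIV_I principal_le_iff top_greatest
        trivial_limit_at_top_linorder principal_UNIV UNIV_I)
  then have "(F \<longlongrightarrow> l) at_top" by (simp add: filterlim_def)
  then show ?thesis using that unfolding F_def g_def by blast
qed

section \<open>The stationary covariance on eigenvectors\<close>

text \<open>
  The adjoint eigenvector relation is used on both sides of \<open>S s Q (S s)\<^sup>*\<close>: on the right it
  supplies the factor that makes the operator integral converge in norm, and after pairing with
  \<open>v\<close> it supplies the second exponential.
\<close>

lemma covariance_op_inf_eigenvectors: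
  fixes H :: "'a::{real_inner, banach} set"
  assumes S: "C0_contraction_semigroup H S" and gen: "is_generator H S D T"
    and sa: "self_adjoint H D T" and Q: "linear_operator H H Q"
    and u: "eigenpair D T (- \<mu>) u" and v: "eigenpair D T (- \<nu>) v" and "\<mu> > 0" "\<nu> > 0"
  shows "inner (covariance_op_inf H \<sigma> S Q u) v = \<sigma>\<^sup>2 / (\<mu> + \<nu>) * inner (Q u) v"
proof -
  have "u \<in> H" using u generator_subset[OF S gen] by (auto simp: eigenpair_def)
  then have "Q u \<in> H" using Q by (auto simp: linear_operator_def)
  define g where "g s = exp (- (\<mu> * s)) *\<^sub>R S s (Q u)" for s
  have cov: "covariance_op H \<sigma> S Q t u = \<sigma>\<^sup>2 *\<^sub>R integral {0..t} g" for t
  proof -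
    have "S s (Q (adjoint_op H H (S s) u)) = g s" if "s \<ge> 0" for s
    proof -
      have "Q (exp (- (\<mu> * s)) *\<^sub>R u) = exp (- (\<mu> * s)) *\<^sub>R Q u"
        using Q \<open>u \<in> H\<close> by (simp add: linear_operator_def)
      then show ?thesis
        using semigroup_adjoint_eigenvector[OF S gen sa u that]
          semigroup_scale[OF S that \<open>Q u \<in> H\<close>] by (simp add: g_def)
    qed
    then have "integral {0..t} (\<lambda>s. S s (Q (adjoint_op H H (S s) u))) = integral {0..t} g"
      by (intro integral_cong) auto
    then show ?thesis by (simp add: covariance_op_def)
  qed
  note cont = semigroup_continuous_on[OF S \<open>Q u \<in> H\<close>]
  obtain l where l: "((\<lambda>t. integral {0..t} g) \<longlongrightarrow> l) at_top"
    using damped_integral_converges[OF \<open>\<mu> > 0\<close> cont semigroup_contraction[OF S _ \<open>Q u \<in> H\<close>]]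
    unfolding g_def by blast
  then have "((\<lambda>t. covariance_op H \<sigma> S Q t u) \<longlongrightarrow> \<sigma>\<^sup>2 *\<^sub>R l) at_top"
    unfolding cov by (intro tendsto_intros)
  then have inf: "covariance_op_inf H \<sigma> S Q u = \<sigma>\<^sup>2 *\<^sub>R l"
    unfolding covariance_op_inf_def by (intro tendsto_Lim) auto
  have paired: "inner (integral {0..t} g) v = (1 - exp (- ((\<mu> + \<nu>) * t))) / (\<mu> + \<nu>) * inner (Q u) v"
    if "t \<ge> 0" for t
  proof -
    have "g integrable_on {0..t}"
      unfolding g_def
      by (intro integrable_continuous_interval continuous_intros continuous_on_subset[OF cont]) auto
    then have "((\<lambda>s. inner (g s) v) has_integral inner (integral {0..t} g) v) {0..t}"
      using has_integral_linear[OF integrable_integral bounded_linear_inner_left]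
      by (simp add: o_def)
    moreover have "inner (g s) v = exp (- ((\<mu> + \<nu>) * s)) * inner (Q u) v" if "s \<in> {0..t}" for s
      using semigroup_inner_eigenvector[OF S gen sa v _ \<open>Q u \<in> H\<close>, of s] that
      by (simp add: g_def exp_add [symmetric] algebra_simps)
    ultimately have "((\<lambda>s. exp (- ((\<mu> + \<nu>) * s)) * inner (Q u) v) has_integral
        inner (integral {0..t} g) v) {0..t}"
      by (rule has_integral_eq[rotated])
    moreover have "((\<lambda>s. exp (- ((\<mu> + \<nu>) * s)) * inner (Q u) v) has_integral
        (1 - exp (- ((\<mu> + \<nu>) * t))) / (\<mu> + \<nu>) * inner (Q u) v) {0..t}"
      using has_integral_mult_left[OF exp_damped_integral[of "\<mu> + \<nu>" 0 t], of "inner (Q u) v"]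
        \<open>\<mu> > 0\<close> \<open>\<nu> > 0\<close> that by simp
    ultimately show ?thesis by (rule has_integral_unique)
  qed
  have "((\<lambda>t. inner (integral {0..t} g) v) \<longlongrightarrow> inner l v) at_top"
    using l by (intro tendsto_intros)
  moreover have "\<forall>\<^sub>F t in at_top. (1 - exp (- ((\<mu> + \<nu>) * t))) / (\<mu> + \<nu>) * inner (Q u) v
      = inner (integral {0..t} g) v"
    using eventually_ge_at_top[of 0] by eventually_elim (simp add: paired)
  then have "((\<lambda>t. inner (integral {0..t} g) v) \<longlongrightarrow> (1 - 0) / (\<mu> + \<nu>) * inner (Q u) v) at_top"
    by (rule Lim_transform_eventually[rotated])
      (use \<open>\<mu> > 0\<close> \<open>\<nu> > 0\<close> in \<open>intro tendsto_intros exp_damped_tendsto; simp\<close>)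
  ultimately have "inner l v = 1 / (\<mu> + \<nu>) * inner (Q u) v"
    using tendsto_unique[OF trivial_limit_at_top_linorder] by fastforce
  then show ?thesis by (simp add: inf)
qed

theorem proposition3p1:
  fixes L \<sigma> \<alpha> :: real
    and H DA :: "L2 set" and A Q :: "L2 \<Rightarrow> L2" and S :: "real \<Rightarrow> L2 \<Rightarrow> L2"
    and lam q :: "nat \<Rightarrow> real" and e b :: "nat \<Rightarrow> L2" and j1 j2 :: nat
  assumes "L > 0" and "\<sigma> > 0" and "H = L2_on {0..L}"
    and "linear_operator H DA A"
    and "\<forall>k\<ge>1. eigenpair DA A (- lam k) (e k)"
    and "\<forall>j\<ge>1. \<forall>k\<ge>j. lam j \<le> lam k"
    and "linear_operator H H Q" and "self_adjoint H H Q"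
    and "\<forall>k\<ge>1. eigenpair H Q (q k) (b k)"
    and "orthonormal_basis H b"
    and "\<exists>D::nat. D > 0 \<and> (\<forall>j>D. b j = dirichlet_ef L j)"
    and "\<forall>j\<ge>1. q j > 0"
    and "\<exists>\<gamma>>-1. summable (\<lambda>n. q (Suc n) * dirichlet_ev L (Suc n) powr \<gamma>)"
    and "bounded_operator H Q"
    and "\<alpha> < lam 1"
    and "self_adjoint H DA (\<lambda>u. A u + \<alpha> *\<^sub>R u)"
    and "C0_contraction_semigroup H S"
    and "is_generator H S DA (\<lambda>u. A u + \<alpha> *\<^sub>R u)"
    and "j1 \<ge> 1" and "j2 \<ge> 1"
  shows "summable (\<lambda>n. q (Suc n) * inner (e j1) (b (Suc n)) * inner (e j2) (b (Suc n))) \<and>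
    inner (covariance_op_inf H \<sigma> S Q (e j1)) (e j2) =
      \<sigma>\<^sup>2 / (lam j1 + lam j2 - 2 * \<alpha>) *
        (\<Sum>n. q (Suc n) * inner (e j1) (b (Suc n)) * inner (e j2) (b (Suc n)))"
proof -
  let ?T = "\<lambda>u. A u + \<alpha> *\<^sub>R u"
  have ev: "eigenpair DA ?T (- (lam j - \<alpha>)) (e j)" and pos: "lam j - \<alpha> > 0" and eH: "e j \<in> H"
    if "j \<ge> 1" for j
  proof -
    have "eigenpair DA A (- lam j) (e j)" using assms(5) that by blast
    then show "eigenpair DA ?T (- (lam j - \<alpha>)) (e j)"
      by (simp add: eigenpair_def algebra_simps)
    have "lam 1 \<le> lam j" using assms(6) that by simp
    then show "lam j - \<alpha> > 0" using assms(15) by simp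
    show "e j \<in> H"
      using \<open>eigenpair DA A (- lam j) (e j)\<close> assms(4) by (auto simp: eigenpair_def linear_operator_def)
  qed
  have sums: "(\<lambda>n. q (Suc n) * inner (e j1) (b (Suc n)) * inner (e j2) (b (Suc n)))
      sums inner (Q (e j1)) (e j2)"
    using assms(8-10) eH[OF \<open>j1 \<ge> 1\<close>] eH[OF \<open>j2 \<ge> 1\<close>] by (intro diagonal_operator_sums) auto
  have "inner (covariance_op_inf H \<sigma> S Q (e j1)) (e j2)
      = \<sigma>\<^sup>2 / ((lam j1 - \<alpha>) + (lam j2 - \<alpha>)) * inner (Q (e j1)) (e j2)"
    using covariance_op_inf_eigenvectors[OF assms(17,18,16,7) ev ev pos pos, of j1 j2] assms(19,20)
    by blast
  moreover have "(lam j1 - \<alpha>) + (lam j2 - \<alpha>) = lam j1 + lam j2 - 2 * \<alpha>"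
    by simp
  ultimately show ?thesis
    using sums by (simp add: sums_iff)
qed

end
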